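(* Let $H$ be a Hilbert space, let $A(t)$, $t\ge0$, be bounded linear operators in $H$, let $F:[0,\infty)\times H\to H$ be a nonlinear map, and let $b:[0,\infty)\to H$ with $b\not\equiv0$. Assume that there are positive constants $c_0,c_1,c_2,q_1,q_2,\nu$ and $p>1$, and a continuous function $\beta:[0,\infty)\to[0,\infty)$, such that for all $t\ge0$ and all $u\in H$ $$\mathrm{Re}(A(t)u,u)\le-\frac{c_1}{(1+t)^{q_1}}\|u\|^2,\qquad\|F(t,u)\|\le c_0\|u\|^p,\qquad\|b(t)\|\le\beta(t)\le\frac{c_2}{(1+t)^{q_2}}.$$ Put $\lambda_0=\left(\frac{(p-1)c_0}{c_2}\right)^{1/p}$ and assume that $$q_1\le\min\{1,\ q_2-\nu,\ \nu(p-1)\},\qquad\|u_0\|\le\lambda_0^{-1},\qquad c_2^{1-\frac1p}c_0^{\frac1p}(p-1)^{\frac1p}\frac{p}{p-1}+\nu\le c_1.$$ Then, under the standing solvability assumption given in the context, the Cauchy problem $\dot u=A(t)u+F(t,u)+b(t)$, $u(0)=u_0$, has a unique global solution $u(t)$, $t\ge0$, and $$\|u(t)\|\le\frac1{\lambda_0(1+t)^\nu}\qquad\forall t\ge0.$$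
   Context: Here $\dot u=du/dt$. Standing solvability assumption: for the given $u_0\in H$ the Cauchy problem has a unique continuously differentiable solution $u:[0,T)\to H$ on a maximal interval of existence $[0,T)$, $0<T\le\infty$ (every continuously differentiable solution on an interval $[0,T')$ is a restriction of $u$), and if $T<\infty$ then $\lim_{t\to T-0}\|u(t)\|=\infty$. (This holds, for example, if the right-hand side is continuous in $t$ and locally Lipschitz in $u$.) *)

theory Defs
  imports "HOL-Analysis.Analysis"
begin

text \<open>
  Hilbert spaces over the real or the complex numbers. Completeness and the topology come from
  the class \<^class>\<open>banach\<close>; the last axiom says that its norm is the one induced by the inner
  product. The scalar field is given as the set \<open>K\<close> of complex numbers, and \<open>smul a\<close> is only
  meaningful for \<open>a \<in> K\<close>. The inner product \<open>ip\<close> is linear in its first argument.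
\<close>

locale hilbert_space =
  fixes K :: "complex set"
    and smul :: "complex \<Rightarrow> 'h::banach \<Rightarrow> 'h"
    and ip :: "'h \<Rightarrow> 'h \<Rightarrow> complex"
  assumes scalars: "K = \<real> \<or> K = UNIV"
    and scale_of_real: "smul (of_real r) x = r *\<^sub>R x"
    and scale_add_right: "a \<in> K \<Longrightarrow> smul a (x + y) = smul a x + smul a y"
    and scale_add_left: "a \<in> K \<Longrightarrow> b \<in> K \<Longrightarrow> smul (a + b) x = smul a x + smul b x"
    and scale_scale: "a \<in> K \<Longrightarrow> b \<in> K \<Longrightarrow> smul a (smul b x) = smul (a * b) x"
    and ip_in_scalars: "ip x y \<in> K"
    and ip_commute: "ip x y = cnj (ip y x)"
    and ip_add_left: "ip (x + y) z = ip x z + ip y z"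
    and ip_scale_left: "a \<in> K \<Longrightarrow> ip (smul a x) y = a * ip x y"
    and ip_self: "ip x x = of_real ((norm x)\<^sup>2)"

lemma hilbert_space_real:
  "hilbert_space \<real> (\<lambda>a x. Re a *\<^sub>R x) (\<lambda>x (y::'a::{real_inner,banach}). of_real (inner x y))"
  by unfold_locales
    (auto simp: scaleR_add_right scaleR_add_left inner_add_left power2_norm_eq_inner
      intro: inner_commute elim!: Reals_cases)

lemma hilbert_space_complex: "hilbert_space UNIV (*) (\<lambda>x y. x * cnj y)"
  by unfold_locales
    (simp_all only: scaleR_conv_of_real complex_norm_square, auto simp: algebra_simps)

definition bounded_operator ::
    "complex set \<Rightarrow> (complex \<Rightarrow> 'h::banach \<Rightarrow> 'h) \<Rightarrow> ('h \<Rightarrow> 'h) \<Rightarrow> bool" where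
  "bounded_operator K smul B \<longleftrightarrow>
     bounded_linear B \<and> (\<forall>a\<in>K. \<forall>x. B (smul a x) = smul a (B x))"

definition time_interval :: "ereal \<Rightarrow> real set" where
  "time_interval T = {t. 0 \<le> t \<and> ereal t < T}"

text \<open>
  \<open>u\<close> is a continuously differentiable solution of \<open>u' = f(t,u)\<close>, \<open>u(0) = u0\<close> on \<open>[0,T)\<close>, with a
  one-sided derivative at \<open>0\<close>; the values of \<open>u\<close> outside \<open>[0,T)\<close> are irrelevant.
\<close>

definition cauchy_solution ::
    "(real \<Rightarrow> 'h \<Rightarrow> 'h) \<Rightarrow> 'h \<Rightarrow> ereal \<Rightarrow> (real \<Rightarrow> 'h::banach) \<Rightarrow> bool" where
  "cauchy_solution f u0 T u \<longleftrightarrow>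
     0 < T \<and> u 0 = u0 \<and>
     (\<exists>u'. continuous_on (time_interval T) u' \<and>
        (\<forall>t\<in>time_interval T.
           (u has_vector_derivative u' t) (at t within time_interval T) \<and> u' t = f t (u t)))"

definition maximal_solution ::
    "(real \<Rightarrow> 'h \<Rightarrow> 'h) \<Rightarrow> 'h \<Rightarrow> ereal \<Rightarrow> (real \<Rightarrow> 'h::banach) \<Rightarrow> bool" where
  "maximal_solution f u0 T u \<longleftrightarrow>
     cauchy_solution f u0 T u \<and>
     (\<forall>T' v. cauchy_solution f u0 T' v \<longrightarrow> T' \<le> T \<and> (\<forall>t\<in>time_interval T'. v t = u t))"

definition solvable :: "(real \<Rightarrow> 'h \<Rightarrow> 'h) \<Rightarrow> 'h::banach \<Rightarrow> bool" where
  "solvable f u0 \<longleftrightarrow>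
     (\<exists>T u. maximal_solution f u0 T u \<and>
        (\<forall>r. T = ereal r \<longrightarrow> filterlim (\<lambda>t. norm (u t)) at_top (at_left r)))"

end

theory Submission
  imports Defs
begin

text \<open>
  Write \<open>g = \<parallel>u\<parallel>\<close> and \<open>W t = 1 / (\<lambda>\<^sub>0 (1 + t)\<^sup>\<nu>)\<close>. Wherever \<open>u \<noteq> 0\<close>,
  differentiating \<open>\<parallel>u\<parallel>\<^sup>2\<close> gives \<open>g' \<le> - c\<^sub>1 (1 + t) powr (-q\<^sub>1) g + c\<^sub>0 g powr p + \<beta>\<close>.
  The choice of \<open>\<lambda>\<^sub>0\<close> minimises \<open>c\<^sub>0 \<lambda> powr (1 - p) + c\<^sub>2 \<lambda>\<close>, and the hypothesis on \<open>c\<^sub>1\<close> says that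
  this minimum plus \<open>\<nu>\<close> is at most \<open>c\<^sub>1\<close>, which makes \<open>W\<close> a (non-strict) supersolution of the same
  scalar inequality. As \<open>x powr p\<close> is locally Lipschitz, \<open>(g - W)' \<le> L (g - W)\<close> wherever \<open>g > W > 0\<close>,
  so \<open>g\<close> never exceeds \<open>W\<close>. In particular \<open>u\<close> cannot blow up in finite time.
\<close>

section \<open>Real part of the inner product and the derivative of the norm\<close>

context hilbert_space
begin

lemma Re_ip_commute: "Re (ip x y) = Re (ip y x)"
  by (subst ip_commute) simp

lemma norm_add_square: "(norm (x + y))\<^sup>2 = (norm x)\<^sup>2 + 2 * Re (ip x y) + (norm y)\<^sup>2"
proof -
  have sq: "(norm z)\<^sup>2 = Re (ip z z)" for z
    by (simp add: ip_self)
  have "ip (x + y) (x + y) = ip x (x + y) + ip y (x + y)"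
    by (rule ip_add_left)
  moreover have "Re (ip x (x + y)) = Re (ip x x) + Re (ip x y)"
    by (subst Re_ip_commute) (simp add: ip_add_left Re_ip_commute)
  moreover have "Re (ip y (x + y)) = Re (ip x y) + Re (ip y y)"
    by (subst Re_ip_commute) (simp add: ip_add_left Re_ip_commute)
  ultimately show ?thesis
    by (simp add: sq del: of_real_power)
qed

lemma Re_ip_scaleR_left: "Re (ip (r *\<^sub>R x) y) = r * Re (ip x y)"
proof -
  have "of_real r \<in> K"
    using scalars by auto
  then show ?thesis
    using ip_scale_left[of "of_real r" x y] by (simp add: scale_of_real)
qed

text \<open>The triangle inequality for the norm is part of the class, so it yields Cauchy-Schwarz.\<close>

lemma Re_ip_le: "Re (ip x y) \<le> norm x * norm y"
proof -
  have "(norm (x + y))\<^sup>2 \<le> (norm x + norm y)\<^sup>2"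
    by (intro power_mono norm_triangle_ineq norm_ge_zero)
  then show ?thesis
    unfolding norm_add_square by (simp add: power2_sum)
qed

text \<open>Makes the product rule for bounded bilinear maps available for the squared norm, over
  real and complex scalars alike.\<close>

lemma bounded_bilinear_Re_ip: "bounded_bilinear (\<lambda>x y. Re (ip x y))"
proof
  fix x x' y y' :: 'h and r :: real
  show "Re (ip (x + x') y) = Re (ip x y) + Re (ip x' y)"
    by (simp add: ip_add_left)
  show "Re (ip x (y + y')) = Re (ip x y) + Re (ip x y')"
    by (subst (1 2 3) Re_ip_commute) (simp add: ip_add_left)
  show "Re (ip (r *\<^sub>R x) y) = r *\<^sub>R Re (ip x y)"
    by (simp add: Re_ip_scaleR_left)
  show "Re (ip x (r *\<^sub>R y)) = r *\<^sub>R Re (ip x y)"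
    by (subst (1 2) Re_ip_commute) (simp add: Re_ip_scaleR_left)
next
  \<comment> \<open>Cauchy-Schwarz for \<open>-x\<close> supplies the lower bound on the real
    part.\<close>
  have "\<bar>Re (ip x y)\<bar> \<le> norm x * norm y" for x y
    using Re_ip_le[of x y] Re_ip_le[of "-x" y] Re_ip_scaleR_left[of "-1" x y] by simp
  then show "\<exists>C. \<forall>x y. norm (Re (ip x y)) \<le> norm x * norm y * C"
    by (intro exI[of _ 1]) simp
qed

text \<open>The norm is the square root of a differentiable function; the square root is
  differentiable only away from zero, hence the condition on \<open>u t\<close>.\<close>

lemma has_real_derivative_norm:
  assumes "(u has_vector_derivative d) (at t)" and "u t \<noteq> 0"
  shows "((\<lambda>t. norm (u t)) has_real_derivative Re (ip d (u t)) / norm (u t)) (at t)"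
proof -
  have norm_eq: "norm (u s) = sqrt (Re (ip (u s) (u s)))" for s
    by (simp add: ip_self del: of_real_power)
  have "((\<lambda>s. Re (ip (u s) (u s))) has_vector_derivative Re (ip (u t) d) + Re (ip d (u t))) (at t)"
    by (intro bounded_bilinear.has_vector_derivative[OF bounded_bilinear_Re_ip] assms)
  then have "((\<lambda>s. Re (ip (u s) (u s))) has_real_derivative 2 * Re (ip d (u t))) (at t)"
    by (simp add: has_real_derivative_iff_has_vector_derivative Re_ip_commute[of "u t"])
  moreover have "Re (ip (u t) (u t)) > 0"
    using assms(2) by (simp add: ip_self del: of_real_power)
  ultimately have "((\<lambda>s. sqrt (Re (ip (u s) (u s)))) has_real_derivative
      inverse (sqrt (Re (ip (u t) (u t)))) / 2 * (2 * Re (ip d (u t)))) (at t)"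
    by (intro DERIV_chain2[OF DERIV_real_sqrt])
  then show ?thesis
    unfolding norm_eq by (simp add: field_simps)
qed

end

section \<open>Scalar comparison principle\<close>

text \<open>If \<open>h b\<close> were positive, \<open>h\<close> would be positive after the last
  point \<open>s\<close> with \<open>h s \<le> 0\<close>, and Gronwall on \<open>[s, b]\<close>
  would force \<open>h b \<le> 0\<close>. Differentiability is asked only where \<open>h\<close> is
  positive because the norm need not be differentiable at zeros of \<open>u\<close>.\<close>

lemma nonpos_if_deriv_le_where_pos:
  fixes h :: "real \<Rightarrow> real"
  assumes "a \<le> b" and cont: "continuous_on {a..b} h" and "h a \<le> 0"
    and deriv: "\<And>t. a < t \<Longrightarrow> t < b \<Longrightarrow> h t > 0 \<Longrightarrow>
      \<exists>d. (h has_real_derivative d) (at t) \<and> d \<le> L * h t"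
  shows "h b \<le> 0"
proof (rule ccontr)
  assume "\<not> h b \<le> 0"
  let ?S = "{t \<in> {a..b}. h t \<le> 0}"
  have "closed ?S"
    using continuous_on_closed_Collect_le[OF cont continuous_on_const closed_atLeastAtMost] by simp
  then have "compact ({a..b} \<inter> ?S)"
    by (intro compact_Int_closed compact_Icc)
  also have "{a..b} \<inter> ?S = ?S"
    by auto
  finally have "compact ?S" .
  moreover have "a \<in> ?S"
    using assms by auto
  ultimately obtain s where s: "s \<in> ?S" and max: "\<And>t. t \<in> ?S \<Longrightarrow> t \<le> s"
    using compact_attains_sup[of ?S] by blast
  from s have "a \<le> s" "h s \<le> 0" "s \<le> b"
    by auto
  with \<open>\<not> h b \<le> 0\<close> have "s < b"
    by (cases "s = b") auto
  \<comment> \<open>Integrating factor: it turns the bound \<open>d \<le> L * h t\<close> into a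
    nonpositive derivative.\<close>
  let ?k = "\<lambda>t. exp (- L * t) * h t"
  have "?k b \<le> ?k s"
  proof (rule DERIV_nonpos_imp_decreasing_open[where f = ?k])
    fix t assume t: "s < t" "t < b"
    then have pos: "h t > 0"
      using max[of t] \<open>a \<le> s\<close> by force
    then obtain d where d: "(h has_real_derivative d) (at t)" "d \<le> L * h t"
      using deriv[of t] t \<open>a \<le> s\<close> by auto
    have "(?k has_real_derivative exp (- L * t) * (d - L * h t)) (at t)"
      using d(1) by (auto intro!: derivative_eq_intros simp: algebra_simps)
    moreover have "exp (- L * t) * (d - L * h t) \<le> 0"
      using d(2) by (simp add: mult_nonneg_nonpos)
    ultimately show "\<exists>y. (?k has_real_derivative y) (at t) \<and> y \<le> 0"
      by blast
  next
    show "continuous_on {s..b} ?k"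
      using \<open>a \<le> s\<close> by (intro continuous_intros continuous_on_subset[OF cont]) auto
  qed (use \<open>s < b\<close> in simp)
  also have "\<dots> \<le> 0"
    using \<open>h s \<le> 0\<close> by (simp add: mult_nonneg_nonpos)
  finally show False
    using \<open>\<not> h b \<le> 0\<close> by (simp add: mult_le_0_iff)
qed

text \<open>Mean value theorem: the derivative of \<open>x powr p\<close> is nondecreasing for
  \<open>p \<ge> 1\<close>, so on \<open>(0, M]\<close> it is largest at \<open>M\<close>.\<close>

lemma powr_diff_le:
  fixes x y M p :: real
  assumes "0 < y" "y \<le> x" "x \<le> M" "1 \<le> p"
  shows "x powr p - y powr p \<le> p * M powr (p - 1) * (x - y)"
proof (cases "y = x")
  case False
  with assms have "y < x"
    by simp
  then obtain z where z: "y < z" "z < x" "x powr p - y powr p = (x - y) * (p * z powr (p - 1))"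
    using MVT2[of y x "\<lambda>x. x powr p" "\<lambda>x. p * x powr (p - 1)"] has_real_derivative_powr assms
    by (metis less_le_trans)
  moreover have "z powr (p - 1) \<le> M powr (p - 1)"
    using z assms by (intro powr_mono2) auto
  ultimately show ?thesis
    using assms by (simp add: mult_left_mono mult.commute mult.assoc)
qed simp

section \<open>The decaying majorant\<close>

text \<open>After a factor \<open>W\<close> is taken out, the nonlinear term, the source and the
  derivative decay with exponents \<open>\<nu> * (p - 1)\<close>, \<open>q2 - \<nu>\<close> and
  \<open>1\<close>. The conditions on \<open>q1\<close> bound all three by the decay
  \<open>s\<close> of the damping, which leaves an inequality between coefficients.\<close>

lemma supersolution:
  fixes c0 c1 c2 q1 q2 \<nu> p lambda0 t :: real
  assumes pos: "c0 > 0" "c2 > 0" "\<nu> > 0" "p > 1" and "t \<ge> 0"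
    and lambda0: "lambda0 = ((p - 1) * c0 / c2) powr (1 / p)"
    and q1: "q1 \<le> 1" "q1 \<le> q2 - \<nu>" "q1 \<le> \<nu> * (p - 1)"
    and c1: "c2 powr (1 - 1 / p) * c0 powr (1 / p) * (p - 1) powr (1 / p) * (p / (p - 1)) + \<nu> \<le> c1"
  defines "W \<equiv> 1 / (lambda0 * (1 + t) powr \<nu>)"
  shows "- (c1 / (1 + t) powr q1) * W + c0 * W powr p + c2 / (1 + t) powr q2 \<le> - (\<nu> / (1 + t)) * W"
proof -
  define s where "s = (1 + t) powr (- q1)"
  have l: "lambda0 > 0"
    unfolding lambda0 using pos by simp
  have W: "W = (1 + t) powr (- \<nu>) / lambda0"
    unfolding W_def by (simp add: powr_minus field_simps)
  have W0: "W > 0"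
    unfolding W using l \<open>t \<ge> 0\<close> by simp
  have lp: "lambda0 powr p = (p - 1) * c0 / c2"
    unfolding lambda0 using pos by (simp add: powr_powr)
  have mono: "(1 + t) powr (- r) \<le> s" if "q1 \<le> r" for r
    unfolding s_def using that \<open>t \<ge> 0\<close> by (intro powr_mono) auto
  have "c0 * W powr p = c0 * W * ((1 + t) powr (- (\<nu> * (p - 1))) * (lambda0 / lambda0 powr p))"
  proof -
    have "W powr p = W * W powr (p - 1)"
      using W0 powr_mult_base[of W "p - 1"] by simp
    also have "W powr (p - 1) = (1 + t) powr (- (\<nu> * (p - 1))) / lambda0 powr (p - 1)"
      unfolding W using l \<open>t \<ge> 0\<close> by (simp add: powr_divide powr_powr)
    also have "lambda0 powr (p - 1) = lambda0 powr p / lambda0"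
      using l by (simp add: powr_diff)
    finally show ?thesis
      by (simp add: field_simps)
  qed
  also have "\<dots> \<le> c0 * W * (s * (lambda0 / lambda0 powr p))"
    using pos W0 l q1 by (intro mult_left_mono mult_right_mono mono) auto
  \<comment> \<open>By the choice of \<open>lambda0\<close>, the nonlinear coefficient
    \<open>c0 * lambda0 powr (1 - p)\<close> equals \<open>c2 * lambda0 / (p - 1)\<close>.\<close>
  also have "\<dots> = (c2 * lambda0 / (p - 1)) * (s * W)"
    unfolding lp using pos by (simp add: field_simps)
  finally have F: "c0 * W powr p \<le> (c2 * lambda0 / (p - 1)) * (s * W)" .
  have "c2 / (1 + t) powr q2 = c2 * lambda0 * (1 + t) powr (- (q2 - \<nu>)) * W"
    unfolding W using l \<open>t \<ge> 0\<close> by (simp add: powr_minus powr_diff field_simps)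
  also have "\<dots> \<le> c2 * lambda0 * s * W"
    using pos W0 l q1 by (intro mult_left_mono mult_right_mono mono) auto
  finally have B: "c2 / (1 + t) powr q2 \<le> (c2 * lambda0) * (s * W)"
    by (simp add: mult.assoc)
  have "\<nu> / (1 + t) * W = \<nu> * (1 + t) powr (- 1) * W"
    using \<open>t \<ge> 0\<close> by (simp add: powr_minus field_simps)
  also have "\<dots> \<le> \<nu> * s * W"
    using pos W0 q1 by (intro mult_left_mono mult_right_mono mono) auto
  finally have N: "\<nu> / (1 + t) * W \<le> \<nu> * (s * W)"
    by (simp add: mult.assoc)
  \<comment> \<open>The first summand in the hypothesis on \<open>c1\<close> is
    \<open>c2 * lambda0 * (p / (p - 1))\<close>. Since \<open>p / (p - 1) = 1 / (p - 1) + 1\<close>,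
    it splits into the coefficients of the nonlinear term and of the source.\<close>
  have "c2 powr (1 - 1 / p) * c0 powr (1 / p) * (p - 1) powr (1 / p) = c2 * lambda0"
    unfolding lambda0 using pos by (simp add: powr_diff powr_divide powr_mult)
  then have "c2 * lambda0 * (p / (p - 1)) + \<nu> \<le> c1"
    using c1 by simp
  moreover have "c2 * lambda0 * (p / (p - 1)) = c2 * lambda0 / (p - 1) + c2 * lambda0"
    using pos by (simp add: field_simps)
  ultimately have "(c2 * lambda0 / (p - 1) + c2 * lambda0 + \<nu>) * (s * W) \<le> c1 * (s * W)"
    using W0 by (intro mult_right_mono) (auto simp: s_def)
  moreover have "c1 / (1 + t) powr q1 * W = c1 * (s * W)"
    unfolding s_def using \<open>t \<ge> 0\<close> by (simp add: powr_minus field_simps)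
  ultimately show ?thesis
    using F B N by (simp add: algebra_simps)
qed

lemma has_real_derivative_decay:
  fixes t \<nu> c :: real
  assumes "t \<ge> 0" and "c \<noteq> 0"
  shows "((\<lambda>t. 1 / (c * (1 + t) powr \<nu>)) has_real_derivative
    - (\<nu> / (1 + t)) * (1 / (c * (1 + t) powr \<nu>))) (at t)"
proof -
  have "((\<lambda>t. (1 + t) powr (- \<nu>) / c) has_real_derivative
      - \<nu> * (1 + t) powr (- \<nu> - 1) / c) (at t)"
    using assms by (auto intro!: derivative_eq_intros)
  then show ?thesis
    using assms by (simp add: powr_minus powr_diff field_simps)
qed

section \<open>A priori bound for solutions\<close>

lemma (in hilbert_space) cauchy_solution_norm_le:
  fixes T :: ereal and t1 :: real
  assumes pos: "c0 > 0" "c1 > 0" "c2 > 0" "\<nu> > 0" "p > 1"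
    and A: "\<And>t u. t \<ge> 0 \<Longrightarrow> Re (ip (A t u) u) \<le> - (c1 / (1 + t) powr q1) * (norm u)\<^sup>2"
    and F: "\<And>t u. t \<ge> 0 \<Longrightarrow> norm (F t u) \<le> c0 * norm u powr p"
    and b: "\<And>t. t \<ge> 0 \<Longrightarrow> norm (b t) \<le> c2 / (1 + t) powr q2"
    and lambda0: "lambda0 = ((p - 1) * c0 / c2) powr (1 / p)"
    and q1: "q1 \<le> 1" "q1 \<le> q2 - \<nu>" "q1 \<le> \<nu> * (p - 1)"
    and u0: "norm u0 \<le> 1 / lambda0"
    and c1: "c2 powr (1 - 1 / p) * c0 powr (1 / p) * (p - 1) powr (1 / p) * (p / (p - 1)) + \<nu> \<le> c1"
    and sol: "cauchy_solution (\<lambda>t x. A t x + F t x + b t) u0 T u"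
    and t1: "t1 \<in> time_interval T"
  shows "norm (u t1) \<le> 1 / (lambda0 * (1 + t1) powr \<nu>)"
proof -
  let ?W = "\<lambda>t. 1 / (lambda0 * (1 + t) powr \<nu>)"
  let ?h = "\<lambda>t. norm (u t) - ?W t"
  have l: "lambda0 > 0"
    unfolding lambda0 using pos by simp
  have "t1 \<ge> 0"
    using t1 by (simp add: time_interval_def)
  have sub: "{0..t1} \<subseteq> time_interval T"
    using t1 by (auto simp: time_interval_def intro: le_less_trans[rotated])
  have u: "(u has_vector_derivative A t (u t) + F t (u t) + b t) (at t within time_interval T)"
    if "t \<in> time_interval T" for t
    using sol that unfolding cauchy_solution_def by metis
  have contu: "continuous_on {0..t1} u"
    by (rule continuous_on_subset[OF _ sub])
      (use u has_vector_derivative_continuous continuous_on_eq_continuous_within in blast)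
  \<comment> \<open>The bound \<open>M\<close> enters only the Lipschitz constant \<open>L\<close>,
    so it may depend on \<open>u\<close> and \<open>t1\<close>.\<close>
  have "compact ((\<lambda>t. norm (u t)) ` {0..t1})"
    by (intro compact_continuous_image continuous_intros contu compact_Icc)
  then obtain M where M: "\<forall>t\<in>{0..t1}. norm (u t) \<le> M"
    by (auto dest!: compact_imp_bounded bounded_imp_bdd_above simp: bdd_above_def)
  have "?h t1 \<le> 0"
  proof (rule nonpos_if_deriv_le_where_pos[where h = ?h and a = 0 and L = "c0 * (p * M powr (p - 1))"])
    show "continuous_on {0..t1} ?h"
      using l by (intro continuous_intros contu) auto
    show "?h 0 \<le> 0"
      using u0 sol by (simp add: cauchy_solution_def)
  next
    fix t assume t: "0 < t" "t < t1" and "?h t > 0"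
    define g where "g = norm (u t)"
    have W: "?W t > 0"
      using l t by simp
    with \<open>?h t > 0\<close> have g: "?W t < g" "0 < g" "u t \<noteq> 0"
      unfolding g_def by auto
    let ?d = "A t (u t) + F t (u t) + b t"
    \<comment> \<open>Passing to an open interval around \<open>t\<close> turns the derivative
      within the domain into a two-sided one.\<close>
    have "(u has_vector_derivative ?d) (at t within {0<..<t1})"
      using sub t by (intro has_vector_derivative_within_subset[OF u]) auto
    then have "(u has_vector_derivative ?d) (at t)"
      using t by (simp add: at_within_open[of t "{0<..<t1}"])
    then have "(?h has_real_derivative Re (ip ?d (u t)) / g - (- (\<nu> / (1 + t)) * ?W t)) (at t)"
      unfolding g_def using g t l
      by (intro DERIV_diff has_real_derivative_norm has_real_derivative_decay) auto
    moreover have "Re (ip ?d (u t)) / g - (- (\<nu> / (1 + t)) * ?W t) \<le> c0 * (p * M powr (p - 1)) * ?h t"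
    proof -
      have "Re (ip (A t (u t)) (u t)) \<le> - (c1 / (1 + t) powr q1) * g\<^sup>2"
        unfolding g_def using t by (intro A) simp
      moreover have "Re (ip (F t (u t)) (u t)) \<le> c0 * g powr p * g"
        using F[of t "u t"] t Re_ip_le[of "F t (u t)" "u t"] g
        unfolding g_def by (meson less_imp_le mult_right_mono norm_ge_zero order_trans)
      moreover have "Re (ip (b t) (u t)) \<le> c2 / (1 + t) powr q2 * g"
        using b[of t] t Re_ip_le[of "b t" "u t"] g
        unfolding g_def by (meson less_imp_le mult_right_mono norm_ge_zero order_trans)
      ultimately have
        "Re (ip ?d (u t)) \<le> (- (c1 / (1 + t) powr q1) * g + c0 * g powr p + c2 / (1 + t) powr q2) * g"
        by (simp add: ip_add_left algebra_simps power2_eq_square)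
      then have "Re (ip ?d (u t)) / g \<le> - (c1 / (1 + t) powr q1) * g + c0 * g powr p + c2 / (1 + t) powr q2"
        using g by (simp add: pos_divide_le_eq)
      \<comment> \<open>Damping acts more strongly on \<open>g\<close> than on the smaller
        \<open>?W t\<close>, so only the nonlinear term contributes to \<open>L\<close>.\<close>
      moreover have "- (c1 / (1 + t) powr q1) * g \<le> - (c1 / (1 + t) powr q1) * ?W t"
        using g pos t by (intro mult_left_mono_neg) auto
      moreover have "- (c1 / (1 + t) powr q1) * ?W t + c0 * ?W t powr p + c2 / (1 + t) powr q2
          \<le> - (\<nu> / (1 + t)) * ?W t"
        using supersolution[OF pos(1,3-5) _ lambda0 q1 c1] t by simp
      moreover have "c0 * (g powr p - ?W t powr p) \<le> c0 * (p * M powr (p - 1) * (g - ?W t))"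
        using pos g W M t unfolding g_def
        by (intro mult_left_mono powr_diff_le) auto
      ultimately show ?thesis
        unfolding g_def[symmetric] right_diff_distrib[of c0 "g powr p"] mult.assoc by linarith
    qed
    ultimately show "\<exists>d. (?h has_real_derivative d) (at t) \<and> d \<le> c0 * (p * M powr (p - 1)) * ?h t"
      by blast
  qed (fact \<open>t1 \<ge> 0\<close>)
  then show ?thesis
    by simp
qed

section \<open>Global existence and uniqueness\<close>

lemma not_bounded_if_norm_at_top_at_left:
  fixes u :: "real \<Rightarrow> 'a::real_normed_vector"
  assumes "filterlim (\<lambda>t. norm (u t)) at_top (at_left r)" and "a < r"
    and "\<And>t. a \<le> t \<Longrightarrow> t < r \<Longrightarrow> norm (u t) \<le> C"
  shows False
proof -
  have "eventually (\<lambda>t. norm (u t) > C) (at_left r)"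
    using assms(1) by (simp add: filterlim_at_top_dense)
  moreover have "eventually (\<lambda>t. t \<in> {a<..<r}) (at_left r)"
    using \<open>a < r\<close> by (rule eventually_at_left_real)
  ultimately have "eventually (\<lambda>t. False) (at_left r)"
    by eventually_elim (use assms(3) in \<open>auto simp: not_less[symmetric]\<close>)
  then show False
    by (simp add: trivial_limit_at_left_real)
qed

theorem theorem5:
  fixes K :: "complex set"
    and smul :: "complex \<Rightarrow> 'h::banach \<Rightarrow> 'h"
    and ip :: "'h \<Rightarrow> 'h \<Rightarrow> complex"
    and A :: "real \<Rightarrow> 'h \<Rightarrow> 'h"
    and F :: "real \<Rightarrow> 'h \<Rightarrow> 'h"
    and b :: "real \<Rightarrow> 'h"
    and \<beta> :: "real \<Rightarrow> real"
    and u0 :: 'h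
    and c0 c1 c2 q1 q2 \<nu> p lambda0 :: real
  assumes "hilbert_space K smul ip"
    and "\<And>t. t \<ge> 0 \<Longrightarrow> bounded_operator K smul (A t)"
    and "\<exists>t\<ge>0. b t \<noteq> 0"
    and "c0 > 0" "c1 > 0" "c2 > 0" "q1 > 0" "q2 > 0" "\<nu> > 0" "p > 1"
    and "continuous_on {0..} \<beta>"
    and "\<And>t. t \<ge> 0 \<Longrightarrow> \<beta> t \<ge> 0"
    and "\<And>t u. t \<ge> 0 \<Longrightarrow> Re (ip (A t u) u) \<le> - (c1 / (1 + t) powr q1) * (norm u)\<^sup>2"
    and "\<And>t u. t \<ge> 0 \<Longrightarrow> norm (F t u) \<le> c0 * norm u powr p"
    and "\<And>t. t \<ge> 0 \<Longrightarrow> norm (b t) \<le> \<beta> t"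
    and "\<And>t. t \<ge> 0 \<Longrightarrow> \<beta> t \<le> c2 / (1 + t) powr q2"
    and "lambda0 = ((p - 1) * c0 / c2) powr (1 / p)"
    and "q1 \<le> Min {1, q2 - \<nu>, \<nu> * (p - 1)}"
    and "norm u0 \<le> inverse lambda0"
    and "c2 powr (1 - 1 / p) * c0 powr (1 / p) * (p - 1) powr (1 / p) * (p / (p - 1)) + \<nu> \<le> c1"
    and "solvable (\<lambda>t x. A t x + F t x + b t) u0"
  shows "\<exists>u. cauchy_solution (\<lambda>t x. A t x + F t x + b t) u0 \<infinity> u \<and>
             (\<forall>v. cauchy_solution (\<lambda>t x. A t x + F t x + b t) u0 \<infinity> v \<longrightarrow> (\<forall>t\<ge>0. v t = u t)) \<and>
             (\<forall>t\<ge>0. norm (u t) \<le> 1 / (lambda0 * (1 + t) powr \<nu>))"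
proof -
  interpret hilbert_space K smul ip
    by fact
  let ?f = "\<lambda>t x. A t x + F t x + b t"
  have l: "lambda0 > 0"
    unfolding assms(17) using \<open>c0 > 0\<close> \<open>c2 > 0\<close> \<open>p > 1\<close> by simp
  from \<open>solvable ?f u0\<close> obtain T u where max: "maximal_solution ?f u0 T u"
    and blowup: "\<And>r. T = ereal r \<Longrightarrow> filterlim (\<lambda>t. norm (u t)) at_top (at_left r)"
    unfolding solvable_def by blast
  \<comment> \<open>Uniqueness is part of maximality: every solution is a restriction of
    \<open>u\<close>.\<close>
  from max have sol: "cauchy_solution ?f u0 T u"
    and unique: "\<And>T' v t. cauchy_solution ?f u0 T' v \<Longrightarrow> t \<in> time_interval T' \<Longrightarrow> v t = u t"
    unfolding maximal_solution_def by blast+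
  have q1: "q1 \<le> 1" "q1 \<le> q2 - \<nu>" "q1 \<le> \<nu> * (p - 1)"
    using assms(18) by auto
  have b: "norm (b t) \<le> c2 / (1 + t) powr q2" if "t \<ge> 0" for t
    using assms(15,16) that order_trans by blast
  have u0: "norm u0 \<le> 1 / lambda0"
    using assms(19) by (simp add: inverse_eq_divide)
  have bound: "norm (u t) \<le> 1 / (lambda0 * (1 + t) powr \<nu>)" if "t \<in> time_interval T" for t
    using cauchy_solution_norm_le[OF assms(4-6,9,10,13,14) b assms(17) q1 u0 assms(20) sol that] .
  \<comment> \<open>For finite \<open>T\<close> the majorant stays below its initial value
    \<open>1 / lambda0\<close>, which contradicts blow-up of the norm.\<close>
  have "T = \<infinity>"
  proof (cases T)
    case (real r)
    have "0 < r"
      using sol real by (simp add: cauchy_solution_def)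
    have "norm (u t) \<le> 1 / lambda0" if "0 \<le> t" "t < r" for t
    proof -
      have "1 / (lambda0 * (1 + t) powr \<nu>) \<le> 1 / (lambda0 * 1)"
        using l that \<open>\<nu> > 0\<close>
        by (intro divide_left_mono mult_left_mono ge_one_powr_ge_zero) auto
      with bound[of t] that real show ?thesis
        by (simp add: time_interval_def)
    qed
    then show ?thesis
      using not_bounded_if_norm_at_top_at_left[OF blowup[OF real] \<open>0 < r\<close>] by blast
  next
    case MInf
    with sol show ?thesis
      by (simp add: cauchy_solution_def)
  qed
  moreover have "t \<in> time_interval \<infinity>" if "t \<ge> 0" for t
    using that by (simp add: time_interval_def)
  ultimately show ?thesis
    using sol unique bound by blast
qed

end
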